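(* Let $\Gamma=\langle\alpha_1,\ldots,\alpha_k\rangle\subset\mathbb N^d$ be an affine semigroup and fix $i\le k$. Then $$\mathsf t_i(\Gamma)=\sup\{\mathsf t_i(\gamma):\gamma\in M_i\},$$ where $M_i=\{\varphi_\Gamma(x): x\in\mathrm{Minimals}_\le\mathsf Z(\alpha_i+\Gamma)\}$.
   Context: An affine semigroup is a finitely generated submonoid of $\mathbb N^d$ with minimal generating set $\alpha_1,\ldots,\alpha_k$; $\varphi_\Gamma(z)=z_1\alpha_1+\cdots+z_k\alpha_k$ for $z\in\mathbb N^k$, $\mathsf Z(\gamma)=\varphi_\Gamma^{-1}(\gamma)$, $|z|=z_1+\cdots+z_k$. For $z,w\in\mathbb N^k$, $\gcd(z,w)=(\min(z_l,w_l))_l$ and $\mathrm{dist}(z,w)=\max(|z-\gcd(z,w)|,|w-\gcd(z,w)|)$. For $\gamma\in\Gamma$ with $\gamma-\alpha_i\in\Gamma$, $\mathsf t_i(\gamma)$ is the least $N\in\mathbb N\cup\{\infty\}$ such that for every $z\in\mathsf Z(\gamma)$ there is $w\in\mathsf Z(\gamma)$ with $w_i>0$ and $\mathrm{dist}(z,w)\le N$; and $\mathsf t_i(\Gamma)=\sup\{\mathsf t_i(\gamma):\gamma-\alpha_i\in\Gamma\}$. $\alpha_i+\Gamma=\{\alpha_i+\beta:\beta\in\Gamma\}$, $\mathsf Z(\alpha_i+\Gamma)=\bigcup_{\gamma\in\alpha_i+\Gamma}\mathsf Z(\gamma)$, and $\mathrm{Minimals}_\le$ denotes the set of minimal elements with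 respect to the componentwise partial order $\le$ on $\mathbb N^k$. *)

theory Defs
  imports "HOL-Analysis.Analysis" "HOL-Library.Extended_Nat"
begin

definition is_submonoid :: "'a::comm_monoid_add set \<Rightarrow> bool" where
  "is_submonoid S \<longleftrightarrow> 0 \<in> S \<and> (\<forall>x\<in>S. \<forall>y\<in>S. x + y \<in> S)"

text \<open>
  The dimension \<open>d\<close> and the number \<open>k\<close> of generators are the cardinalities of the finite index
  types \<open>'d\<close> and \<open>'k\<close>; injectivity says that the listed generators are distinct.
\<close>

definition affine_semigroup :: "(nat ^ 'd) set \<Rightarrow> ('k::finite \<Rightarrow> nat ^ 'd) \<Rightarrow> bool" where
  "affine_semigroup \<Gamma> \<alpha> \<longleftrightarrow>
     inj \<alpha> \<and> \<Gamma> = is_submonoid hull range \<alpha> \<and>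
     (\<forall>S. S \<subset> range \<alpha> \<longrightarrow> is_submonoid hull S \<noteq> \<Gamma>)"

definition fact_hom :: "('k::finite \<Rightarrow> nat ^ 'd) \<Rightarrow> nat ^ 'k \<Rightarrow> nat ^ 'd" where
  "fact_hom \<alpha> z = (\<Sum>j\<in>UNIV. z $ j *s \<alpha> j)"

definition factorizations :: "('k::finite \<Rightarrow> nat ^ 'd) \<Rightarrow> nat ^ 'd \<Rightarrow> (nat ^ 'k) set" where
  "factorizations \<alpha> \<gamma> = {z. fact_hom \<alpha> z = \<gamma>}"

definition fact_length :: "nat ^ 'k \<Rightarrow> nat" where
  "fact_length z = (\<Sum>j\<in>UNIV. z $ j)"

definition fact_gcd :: "nat ^ 'k \<Rightarrow> nat ^ 'k \<Rightarrow> nat ^ 'k" where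
  "fact_gcd z w = (\<chi> l. min (z $ l) (w $ l))"

text \<open>
  The truncated subtractions on \<open>nat\<close> below are genuine ones, since \<open>fact_gcd z w\<close> is
  componentwise below both arguments.
\<close>

definition fact_dist :: "nat ^ 'k \<Rightarrow> nat ^ 'k \<Rightarrow> nat" where
  "fact_dist z w =
     max (fact_length (z - fact_gcd z w)) (fact_length (w - fact_gcd z w))"

text \<open>
  Meaningful only for \<open>\<gamma>\<close> with \<open>\<gamma> - \<alpha> i\<close> in the semigroup; then \<open>N = \<infinity>\<close> always qualifies.
\<close>

definition tame_degree_at :: "('k::finite \<Rightarrow> nat ^ 'd) \<Rightarrow> 'k \<Rightarrow> nat ^ 'd \<Rightarrow> enat" where
  "tame_degree_at \<alpha> i \<gamma> =
     (LEAST N. \<forall>z\<in>factorizations \<alpha> \<gamma>. \<exists>w\<in>factorizations \<alpha> \<gamma>.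
        w $ i > 0 \<and> enat (fact_dist z w) \<le> N)"

text \<open>
  The condition \<open>\<alpha> i \<le> \<gamma>\<close> ensures that the truncated \<open>\<gamma> - \<alpha> i\<close> is the difference in
  \<open>\<int>\<^sup>d\<close>.
\<close>

definition tame_degree :: "(nat ^ 'd) set \<Rightarrow> ('k::finite \<Rightarrow> nat ^ 'd) \<Rightarrow> 'k \<Rightarrow> enat" where
  "tame_degree \<Gamma> \<alpha> i =
     Sup {tame_degree_at \<alpha> i \<gamma> | \<gamma>. \<gamma> \<in> \<Gamma> \<and> \<alpha> i \<le> \<gamma> \<and> \<gamma> - \<alpha> i \<in> \<Gamma>}"

definition minimals :: "'a::order set \<Rightarrow> 'a set" where
  "minimals A = {x\<in>A. \<forall>y\<in>A. y \<le> x \<longrightarrow> y = x}"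

definition principal_ideal :: "(nat ^ 'd) set \<Rightarrow> nat ^ 'd \<Rightarrow> (nat ^ 'd) set" where
  "principal_ideal \<Gamma> a = {a + \<beta> | \<beta>. \<beta> \<in> \<Gamma>}"

definition minimal_values :: "(nat ^ 'd) set \<Rightarrow> ('k::finite \<Rightarrow> nat ^ 'd) \<Rightarrow> 'k \<Rightarrow> (nat ^ 'd) set" where
  "minimal_values \<Gamma> \<alpha> i =
     {fact_hom \<alpha> x | x. x \<in> minimals (\<Union>\<gamma>\<in>principal_ideal \<Gamma> (\<alpha> i). factorizations \<alpha> \<gamma>)}"

end

theory Submission
  imports Defs
begin

text \<open>
  Any factorization \<open>z\<close> in \<open>Z(\<alpha>\<^sub>i + \<Gamma>)\<close> dominates a minimal one \<open>x\<close>. A factorization \<open>w\<close> of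
  \<open>\<phi>(x)\<close> with \<open>w\<^sub>i > 0\<close> lifts to the factorization \<open>w + (z - x)\<close> of \<open>\<phi>(z)\<close>, and translating
  both \<open>x\<close> and \<open>w\<close> by \<open>z - x\<close> leaves their distance unchanged.
\<close>

lemma le_iff_add_nat_vec:
  fixes x z :: "nat ^ 'n"
  shows "x \<le> z \<longleftrightarrow> (\<exists>v. z = x + v)"
proof
  assume "x \<le> z"
  then have "z = x + (z - x)"
    by (simp add: vec_eq_iff less_eq_vec_def)
  then show "\<exists>v. z = x + v" ..
qed (auto simp: less_eq_vec_def)

lemma strict_mono_fact_length: "strict_mono fact_length"
proof
  fix x y :: "nat ^ 'n"
  assume "x < y"
  then have "\<forall>l. x $ l \<le> y $ l" "\<exists>l. x $ l < y $ l"
    unfolding less_vec_def less_eq_vec_def by (auto simp: not_le)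
  then show "fact_length x < fact_length y"
    unfolding fact_length_def by (intro sum_strict_mono_ex1) auto
qed

lemma wfp_less_nat_vec: "wfp ((<) :: nat ^ 'n \<Rightarrow> nat ^ 'n \<Rightarrow> bool)"
  by (rule wfp_if_convertible_to_nat) (rule strict_monoD[OF strict_mono_fact_length])

lemma minimals_below:
  fixes A :: "'a::order set"
  assumes "wfp_on A (<)" and "z \<in> A"
  obtains x where "x \<in> minimals A" "x \<le> z"
proof -
  have "{y \<in> A. y \<le> z} \<subseteq> A" "{y \<in> A. y \<le> z} \<noteq> {}"
    using assms(2) by auto
  then obtain x where "x \<in> A" "x \<le> z" and "\<And>y. y < x \<Longrightarrow> y \<notin> {y \<in> A. y \<le> z}"
    using assms(1) unfolding wfp_on_iff_ex_minimal by blast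
  then have "x \<in> minimals A"
    by (force simp: minimals_def order.order_iff_strict)
  with \<open>x \<le> z\<close> show thesis
    by (rule that[rotated])
qed

lemma is_submonoid_sum:
  assumes "is_submonoid S" and "\<And>j. j \<in> J \<Longrightarrow> f j \<in> S"
  shows "sum f J \<in> S"
  using assms by (induction J rule: infinite_finite_induct) (auto simp: is_submonoid_def)

lemma is_submonoid_nat_smult:
  fixes S :: "(nat ^ 'd) set"
  assumes "is_submonoid S" and "a \<in> S"
  shows "n *s a \<in> S"
proof (induction n)
  case (Suc n)
  then have "a + n *s a \<in> S"
    using assms by (auto simp: is_submonoid_def)
  moreover have "Suc n *s a = a + n *s a"
    by (simp add: vec_eq_iff)
  ultimately show ?case by simp
qed (use assms in \<open>simp add: is_submonoid_def\<close>)

lemma fact_hom_zero: "fact_hom \<alpha> 0 = 0"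
  by (simp add: fact_hom_def)

lemma fact_hom_add: "fact_hom \<alpha> (z + w) = fact_hom \<alpha> z + fact_hom \<alpha> w"
  by (simp add: fact_hom_def vector_sadd_rdistrib sum.distrib)

lemma fact_hom_axis: "fact_hom \<alpha> (axis j 1) = \<alpha> j"
proof -
  have "axis j 1 $ l *s \<alpha> l = (if l = j then \<alpha> j else 0)" for l
    by (simp add: axis_def del: One_nat_def)
  then show ?thesis
    by (simp add: fact_hom_def)
qed

lemma submonoid_hull_eq_range_fact_hom:
  "is_submonoid hull range \<alpha> = range (fact_hom \<alpha>)"
proof (rule hull_unique)
  show "range \<alpha> \<subseteq> range (fact_hom \<alpha>)"
    by (metis fact_hom_axis image_subsetI rangeI)
  show "is_submonoid (range (fact_hom \<alpha>))"
    unfolding is_submonoid_def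
    by (auto simp flip: fact_hom_add intro: range_eqI[of _ _ 0] simp: fact_hom_zero)
  show "range (fact_hom \<alpha>) \<subseteq> S" if "range \<alpha> \<subseteq> S" "is_submonoid S" for S
    using that by (auto simp: fact_hom_def intro!: is_submonoid_sum is_submonoid_nat_smult)
qed

lemma affine_semigroup_eq_range_fact_hom:
  "affine_semigroup \<Gamma> \<alpha> \<Longrightarrow> \<Gamma> = range (fact_hom \<alpha>)"
  by (simp add: affine_semigroup_def submonoid_hull_eq_range_fact_hom)

lemma principal_ideal_iff:
  fixes a \<gamma> :: "nat ^ 'd"
  shows "\<gamma> \<in> principal_ideal \<Gamma> a \<longleftrightarrow> a \<le> \<gamma> \<and> \<gamma> - a \<in> \<Gamma>"
proof -
  have "a + \<beta> - a = \<beta>" for \<beta>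
    by (simp add: vec_eq_iff)
  then show ?thesis
    by (auto simp: principal_ideal_def le_iff_add_nat_vec)
qed

lemma axis_one_le_iff:
  fixes w :: "nat ^ 'n"
  shows "axis i 1 \<le> w \<longleftrightarrow> 0 < w $ i"
  by (auto simp: less_eq_vec_def axis_def Suc_le_eq)

lemma principal_ideal_eq_image_fact_hom:
  assumes "affine_semigroup \<Gamma> \<alpha>"
  shows "principal_ideal \<Gamma> (\<alpha> i) = fact_hom \<alpha> ` {w. 0 < w $ i}"
proof -
  have positive: "{w. 0 < w $ i} = range (\<lambda>u. axis i (1::nat) + u)"
    by (auto simp: le_iff_add_nat_vec simp flip: axis_one_le_iff)
  have "principal_ideal \<Gamma> (\<alpha> i) = range (\<lambda>u. fact_hom \<alpha> (axis i 1 + u))"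
    unfolding fact_hom_add fact_hom_axis principal_ideal_def
      affine_semigroup_eq_range_fact_hom[OF assms] by auto
  then show ?thesis
    by (simp add: positive image_image)
qed

lemma minimal_values_eq:
  "minimal_values \<Gamma> \<alpha> i = fact_hom \<alpha> ` minimals (fact_hom \<alpha> -` principal_ideal \<Gamma> (\<alpha> i))"
proof -
  have "(\<Union>\<gamma>\<in>principal_ideal \<Gamma> (\<alpha> i). factorizations \<alpha> \<gamma>) =
      fact_hom \<alpha> -` principal_ideal \<Gamma> (\<alpha> i)"
    by (auto simp: factorizations_def)
  then show ?thesis
    by (auto simp: minimal_values_def)
qed

lemma minimal_values_subset: "minimal_values \<Gamma> \<alpha> i \<subseteq> principal_ideal \<Gamma> (\<alpha> i)"
  by (auto simp: minimal_values_eq minimals_def)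

lemma fact_dist_translate: "fact_dist (z + v) (w + v) = fact_dist z w"
proof -
  have "fact_gcd (z + v) (w + v) = fact_gcd z w + v"
    by (simp add: fact_gcd_def vec_eq_iff min_add_distrib_left)
  then show ?thesis
    by (simp add: fact_dist_def fact_length_def)
qed

definition generator_reachable ::
    "('k::finite \<Rightarrow> nat ^ 'd) \<Rightarrow> 'k \<Rightarrow> enat \<Rightarrow> nat ^ 'k \<Rightarrow> bool" where
  "generator_reachable \<alpha> i N z \<longleftrightarrow>
     (\<exists>w\<in>factorizations \<alpha> (fact_hom \<alpha> z). 0 < w $ i \<and> enat (fact_dist z w) \<le> N)"

lemma generator_reachable_mono:
  assumes "generator_reachable \<alpha> i N x" and "x \<le> z"
  shows "generator_reachable \<alpha> i N z"
proof -
  obtain v where z: "z = x + v"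
    using \<open>x \<le> z\<close> by (auto simp: le_iff_add_nat_vec)
  obtain w where w: "fact_hom \<alpha> w = fact_hom \<alpha> x" "0 < w $ i" "enat (fact_dist x w) \<le> N"
    using assms(1) by (auto simp: generator_reachable_def factorizations_def)
  have "w + v \<in> factorizations \<alpha> (fact_hom \<alpha> z)"
    using w(1) by (simp add: z factorizations_def fact_hom_add)
  moreover have "0 < (w + v) $ i" "enat (fact_dist z (w + v)) \<le> N"
    using w(2,3) by (simp_all add: z fact_dist_translate)
  ultimately show ?thesis
    unfolding generator_reachable_def by blast
qed

lemma tame_degree_at_le_iff:
  assumes "affine_semigroup \<Gamma> \<alpha>" and "\<gamma> \<in> principal_ideal \<Gamma> (\<alpha> i)"
  shows "tame_degree_at \<alpha> i \<gamma> \<le> N \<longleftrightarrow> (\<forall>z\<in>factorizations \<alpha> \<gamma>. generator_reachable \<alpha> i N z)"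
proof -
  define bounds where
    "bounds N \<longleftrightarrow> (\<forall>z\<in>factorizations \<alpha> \<gamma>. generator_reachable \<alpha> i N z)" for N
  have least: "tame_degree_at \<alpha> i \<gamma> = (LEAST N. bounds N)"
    by (simp add: tame_degree_at_def bounds_def generator_reachable_def factorizations_def)
  have "bounds \<infinity>"
    using assms(2) unfolding principal_ideal_eq_image_fact_hom[OF assms(1)]
    by (auto simp: bounds_def generator_reachable_def factorizations_def)
  then have "bounds (tame_degree_at \<alpha> i \<gamma>)"
    unfolding least by (rule LeastI)
  moreover have "bounds N" if "bounds M" "M \<le> N" for M
    using that unfolding bounds_def generator_reachable_def by (meson order_trans)
  ultimately have "tame_degree_at \<alpha> i \<gamma> \<le> N \<longleftrightarrow> bounds N"
    unfolding least by (blast intro: Least_le)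
  then show ?thesis
    by (simp add: bounds_def)
qed

lemma tame_degree_eq_SUP_principal_ideal:
  assumes "affine_semigroup \<Gamma> \<alpha>"
  shows "tame_degree \<Gamma> \<alpha> i = (SUP \<gamma>\<in>principal_ideal \<Gamma> (\<alpha> i). tame_degree_at \<alpha> i \<gamma>)"
proof -
  have "principal_ideal \<Gamma> (\<alpha> i) \<subseteq> \<Gamma>"
    unfolding principal_ideal_eq_image_fact_hom[OF assms]
    using affine_semigroup_eq_range_fact_hom[OF assms] by blast
  then have "\<gamma> \<in> \<Gamma> \<and> \<alpha> i \<le> \<gamma> \<and> \<gamma> - \<alpha> i \<in> \<Gamma> \<longleftrightarrow> \<gamma> \<in> principal_ideal \<Gamma> (\<alpha> i)" for \<gamma>
    by (auto simp: principal_ideal_iff)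
  then show ?thesis
    by (simp add: tame_degree_def Setcompr_eq_image)
qed

lemma tame_degree_at_le_SUP_minimal_values:
  assumes semigroup: "affine_semigroup \<Gamma> \<alpha>" and \<gamma>: "\<gamma> \<in> principal_ideal \<Gamma> (\<alpha> i)"
  shows "tame_degree_at \<alpha> i \<gamma> \<le> (SUP \<gamma>\<in>minimal_values \<Gamma> \<alpha> i. tame_degree_at \<alpha> i \<gamma>)"
    (is "_ \<le> ?S")
proof -
  have "generator_reachable \<alpha> i ?S z" if "z \<in> factorizations \<alpha> \<gamma>" for z
  proof -
    have "z \<in> fact_hom \<alpha> -` principal_ideal \<Gamma> (\<alpha> i)"
      using that \<gamma> by (simp add: factorizations_def)
    then obtain x where x: "x \<in> minimals (fact_hom \<alpha> -` principal_ideal \<Gamma> (\<alpha> i))" and "x \<le> z"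
      by (rule minimals_below[OF wfp_on_subset[OF wfp_less_nat_vec subset_UNIV]])
    from x have x_value: "fact_hom \<alpha> x \<in> minimal_values \<Gamma> \<alpha> i"
      by (simp add: minimal_values_eq)
    then have "tame_degree_at \<alpha> i (fact_hom \<alpha> x) \<le> ?S"
      by (rule SUP_upper)
    moreover have "fact_hom \<alpha> x \<in> principal_ideal \<Gamma> (\<alpha> i)"
      using x_value minimal_values_subset by blast
    ultimately have "generator_reachable \<alpha> i ?S x"
      by (simp add: tame_degree_at_le_iff[OF semigroup] factorizations_def)
    then show ?thesis
      using \<open>x \<le> z\<close> by (rule generator_reachable_mono)
  qed
  then show ?thesis
    using \<gamma> by (simp add: tame_degree_at_le_iff[OF semigroup])
qed

theorem theorem5p2:
  fixes \<Gamma> :: "(nat ^ 'd) set" and \<alpha> :: "'k::finite \<Rightarrow> nat ^ 'd" and i :: 'k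
  assumes "affine_semigroup \<Gamma> \<alpha>"
  shows "tame_degree \<Gamma> \<alpha> i = Sup {tame_degree_at \<alpha> i \<gamma> | \<gamma>. \<gamma> \<in> minimal_values \<Gamma> \<alpha> i}"
proof -
  have "tame_degree \<Gamma> \<alpha> i = (SUP \<gamma>\<in>principal_ideal \<Gamma> (\<alpha> i). tame_degree_at \<alpha> i \<gamma>)"
    using assms by (rule tame_degree_eq_SUP_principal_ideal)
  also have "\<dots> = (SUP \<gamma>\<in>minimal_values \<Gamma> \<alpha> i. tame_degree_at \<alpha> i \<gamma>)"
  proof (rule antisym)
    show "(SUP \<gamma>\<in>principal_ideal \<Gamma> (\<alpha> i). tame_degree_at \<alpha> i \<gamma>) \<le>
        (SUP \<gamma>\<in>minimal_values \<Gamma> \<alpha> i. tame_degree_at \<alpha> i \<gamma>)"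
      using tame_degree_at_le_SUP_minimal_values[OF assms] by (rule SUP_least)
    show "(SUP \<gamma>\<in>minimal_values \<Gamma> \<alpha> i. tame_degree_at \<alpha> i \<gamma>) \<le>
        (SUP \<gamma>\<in>principal_ideal \<Gamma> (\<alpha> i). tame_degree_at \<alpha> i \<gamma>)"
      using minimal_values_subset by (rule SUP_subset_mono) simp
  qed
  finally show ?thesis
    by (simp add: Setcompr_eq_image)
qed

end
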